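(* Let $\Theta\subset\mathbb{R}^m$ and $f:\mathbb{R}^n\times\Theta\to\mathbb{R}$ satisfy the regularity and definability assumptions, let $O\subset\Theta$ be open and definable, and assume the uniform range condition holds on $O$ with $\bar\varepsilon>0$ and a definable conservative Jacobian $J_F$ of $F=\nabla_xf$ (all defined in the context). Fix $\theta\in O$. Let $\varepsilon_k\downarrow0$ with $0<\varepsilon_k\le\bar\varepsilon$, and select $(H_k\ M_k)\in J_F(x^\star_{\varepsilon_k}(\theta),\theta)$. Set $$R_k:=(H_k+\varepsilon_kI_n)^{-1}H_k,\qquad W_k:=H_k^\dagger M_k,\qquad V_k:=-(H_k+\varepsilon_kI_n)^{-1}M_k=-R_kW_k.$$ Then $V_k\in J_{x^\star_{\varepsilon_k}}(\theta)$, and the sequences $(W_k)_k$ and $(V_k)_k$ are bounded. If $V_k\to V$ along a subsequence, then, after passing to a further common subsequence, $$(H_k\ M_k)\to(H\ M)\in\mathcal{R}(\theta),\qquad W_k\to W,\qquad R_k\to R.$$ Moreover, $M=HW$ and $S:=R-H^\dagger H=\Pi_{\ker H}R\,\Pi_{\ker H}$ with $0\preceq S\preceq\Pi_{\ker H}$, while the limit satisfies $$V=-H^\dagger M-SW\in J_{x^\star_{\min}}(\theta),\qquad HV+M=0.$$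
   Context: Definability is relative to a fixed o-minimal structure expanding the real field; a (set-valued) map is definable if its graph is. $\|\cdot\|$ is the Euclidean/operator norm, $\dagger$ the Moore–Penrose pseudoinverse, $\Pi_E$ the orthogonal projector onto a subspace $E$, $\preceq$ the Loewner order. Conservative Jacobian: for $U\subset\mathbb{R}^d$ open and $G:U\to\mathbb{R}^q$ locally Lipschitz, $J_G:U\rightrightarrows\mathbb{R}^{q\times d}$ is a conservative Jacobian of $G$ on $U$ if it is nonempty-valued, locally bounded, has closed graph, and for every absolutely continuous curve $\mu:[0,1]\to U$ and almost every $t$, $\frac{d}{dt}G(\mu(t))=V\dot\mu(t)$ for all $V\in J_G(\mu(t))$. Regularity assumption: for every $\theta\in\Theta$, $f(\cdot,\theta)$ is $\mathcal{C}^{1,1}(\mathbb{R}^n)$ (differentiable with Lipschitz gradient), convex, and $\mathcal{S}(\theta):=\operatorname{argmin}_xf(x,\theta)\ne\emptyset$; and $F:=\nabla_xf$ is locally Lipschitz jointly in $(x,\theta)$. Definability assumption: $f$ and $\Theta$ are definable. $x^\star_{\min}(\theta)$ is the minimal Euclidean norm element of $\mathcal{S}(\theta)$; for $\varepsilon>0$, $x^\star_\varepsilon(\theta)$ is the unique minimizer of $x\mapsto f(x,\theta)+\frac{\varepsilon}{2}\|x\|_2^2$. Elements of $J_F(x,\theta)$ are written $(H\ M)$ with $H\in\mathbb{R}^{n\times n}$ ($x$-block), $M\in\mathbb{R}^{n\times m}$ ($\theta$-block). Uniform range condition: for every compact $K\subset O$ there exists $C_K>0$ such that, for every $\theta\in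 K$, $0<\varepsilon\le\bar\varepsilon$ and $(H_\varepsilon\ M_\varepsilon)\in J_F(x^\star_\varepsilon(\theta),\theta)$, the block $H_\varepsilon$ is symmetric positive semidefinite and $M_\varepsilon=H_\varepsilon W_\varepsilon$ for some $W_\varepsilon\in\mathbb{R}^{n\times m}$ with $\|W_\varepsilon\|\le C_K$. For $0<\varepsilon\le\bar\varepsilon$: $J_{x^\star_\varepsilon}(\theta):=\{-(H_\varepsilon+\varepsilon I_n)^{-1}M_\varepsilon:(H_\varepsilon\ M_\varepsilon)\in J_F(x^\star_\varepsilon(\theta),\theta)\}$. $J_{x^\star_{\min}}(\theta)$ is the set of $V\in\mathbb{R}^{n\times m}$ for which there exist $\theta_k\in O$, $\theta_k\to\theta$, $\varepsilon_k\downarrow0$ ($0<\varepsilon_k\le\bar\varepsilon$), $V_k\to V$ with $V_k\in J_{x^\star_{\varepsilon_k}}(\theta_k)$ and $x^\star_{\varepsilon_k}(\theta_k)\to x^\star_{\min}(\theta)$. Reachable set: $\mathcal{R}(\theta)$ is the set of $(H\ M)\in J_F(x^\star_{\min}(\theta),\theta)$ for which there exist $\varepsilon_k\downarrow0$ and $(H_k\ M_k)\in J_F(x^\star_{\varepsilon_k}(\theta),\theta)$ with $(H_k\ M_k)\to(H\ M)$. *)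

theory Defs
  imports "HOL-Analysis.Analysis"
begin

section \<open>O-minimal structures expanding the real field\<close>

text \<open>
  A point of the n-dimensional real space is encoded as a list of length n, and
  \<open>\<D> n\<close> is the family of definable subsets of that space. By the last axiom every
  singleton is in \<open>\<D> 1\<close>, so definability is with real parameters.
\<close>

locale ominimal_structure =
  fixes \<D> :: "nat \<Rightarrow> real list set set"
  assumes dimension: "A \<in> \<D> n \<Longrightarrow> xs \<in> A \<Longrightarrow> length xs = n"
    and empty: "{} \<in> \<D> n"
    and complement: "A \<in> \<D> n \<Longrightarrow> {xs. length xs = n} - A \<in> \<D> n"
    and union: "A \<in> \<D> n \<Longrightarrow> B \<in> \<D> n \<Longrightarrow> A \<union> B \<in> \<D> n"
    and cylinder_left: "A \<in> \<D> n \<Longrightarrow> {x # xs |x xs. xs \<in> A} \<in> \<D> (Suc n)"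
    and cylinder_right: "A \<in> \<D> n \<Longrightarrow> {xs @ [x] |x xs. xs \<in> A} \<in> \<D> (Suc n)"
    and diagonal: "i < n \<Longrightarrow> j < n \<Longrightarrow> {xs. length xs = n \<and> xs ! i = xs ! j} \<in> \<D> n"
    and projection: "A \<in> \<D> (Suc n) \<Longrightarrow> butlast ` A \<in> \<D> n"
    and order: "{[x, y] |x y. x < y} \<in> \<D> 2"
    and addition: "{[x, y, x + y] |x y. True} \<in> \<D> 3"
    and multiplication: "{[x, y, x * y] |x y. True} \<in> \<D> 3"
    and ominimal: "A \<in> \<D> 1 \<longleftrightarrow>
      (\<exists>\<I>. finite \<I> \<and> (\<forall>I\<in>\<I>. is_interval I) \<and> A = (\<lambda>x. [x]) ` (\<Union>\<I>))"

text \<open>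
  Coordinates are taken with respect to an enumeration of the standard basis. An o-minimal
  structure is closed under permutations of coordinates, so the choice of the enumeration is
  immaterial.
\<close>

definition definable_in :: "(nat \<Rightarrow> real list set set) \<Rightarrow> 'a::euclidean_space set \<Rightarrow> bool" where
  "definable_in \<D> A \<longleftrightarrow> (\<exists>bs. distinct bs \<and> set bs = (Basis :: 'a set) \<and>
     (\<lambda>x. map (\<lambda>b. x \<bullet> b) bs) ` A \<in> \<D> DIM('a))"


section \<open>Block vectors and block matrices\<close>

definition vconcat :: "real ^ 'n \<Rightarrow> real ^ 'm \<Rightarrow> real ^ ('n::finite + 'm::finite)" where
  "vconcat x y = (\<chi> i. case i of Inl a \<Rightarrow> x $ a | Inr b \<Rightarrow> y $ b)"

definition vfst :: "real ^ ('n::finite + 'm::finite) \<Rightarrow> real ^ 'n" where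
  "vfst z = (\<chi> i. z $ Inl i)"

definition vsnd :: "real ^ ('n::finite + 'm::finite) \<Rightarrow> real ^ 'm" where
  "vsnd z = (\<chi> j. z $ Inr j)"

text \<open>The block matrix \<open>(H M)\<close>.\<close>

definition hcat :: "real ^ 'n ^ 'k \<Rightarrow> real ^ 'm ^ 'k \<Rightarrow> real ^ ('n::finite + 'm::finite) ^ 'k" where
  "hcat H M = (\<chi> i. vconcat (H $ i) (M $ i))"


section \<open>Matrix notions\<close>

definition penrose_inverse :: "real ^ 'n ^ 'm \<Rightarrow> real ^ 'm ^ 'n \<Rightarrow> bool" where
  "penrose_inverse A X \<longleftrightarrow>
     A ** X ** A = A \<and> X ** A ** X = X \<and>
     transpose (A ** X) = A ** X \<and> transpose (X ** A) = X ** A"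

definition pinv :: "real ^ 'n ^ 'm \<Rightarrow> real ^ 'm ^ 'n" where
  "pinv A = (THE X. penrose_inverse A X)"

definition ker :: "real ^ 'n ^ 'm \<Rightarrow> (real ^ 'n) set" where
  "ker A = {x. A *v x = 0}"

definition proj_mat :: "(real ^ 'n) set \<Rightarrow> real ^ 'n ^ 'n" where
  "proj_mat E = (THE P. \<forall>x. P *v x \<in> E \<and> x - P *v x \<in> E\<^sup>\<bottom>)"

definition sym_psd :: "real ^ 'n ^ 'n \<Rightarrow> bool" where
  "sym_psd A \<longleftrightarrow> transpose A = A \<and> (\<forall>x. 0 \<le> x \<bullet> (A *v x))"

definition loewner_le :: "real ^ 'n ^ 'n \<Rightarrow> real ^ 'n ^ 'n \<Rightarrow> bool"  (infix \<open>\<preceq>\<^sub>L\<close> 50) where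
  "A \<preceq>\<^sub>L B \<longleftrightarrow> sym_psd (B - A)"


section \<open>Conservative Jacobians\<close>

definition locally_lipschitz_on ::
  "'a::metric_space set \<Rightarrow> ('a \<Rightarrow> 'b::metric_space) \<Rightarrow> bool" where
  "locally_lipschitz_on U G \<longleftrightarrow> (\<forall>z\<in>U. \<exists>r>0. \<exists>L. L-lipschitz_on (ball z r \<inter> U) G)"

text \<open>
  Absolute continuity on an interval: the sets \<open>d\<close> range over the finite families of
  nonoverlapping compact subintervals.
\<close>

definition abs_continuous_on :: "real set \<Rightarrow> (real \<Rightarrow> 'a::real_normed_vector) \<Rightarrow> bool" where
  "abs_continuous_on I \<mu> \<longleftrightarrow>
     (\<forall>e>0. \<exists>\<delta>>0. \<forall>d. d division_of \<Union>d \<longrightarrow> \<Union>d \<subseteq> I \<longrightarrow> (\<Sum>K\<in>d. Sup K - Inf K) < \<delta> \<longrightarrow>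
        (\<Sum>K\<in>d. norm (\<mu> (Sup K) - \<mu> (Inf K))) < e)"

text \<open>The graph is required to be closed relative to \<open>U \<times> UNIV\<close>, as \<open>J\<close> is a map on \<open>U\<close>.\<close>

definition conservative_jacobian ::
  "(real ^ 'd) set \<Rightarrow> (real ^ 'd \<Rightarrow> real ^ 'q) \<Rightarrow> (real ^ 'd \<Rightarrow> (real ^ 'd ^ 'q) set) \<Rightarrow> bool" where
  "conservative_jacobian U G J \<longleftrightarrow>
     open U \<and> locally_lipschitz_on U G \<and>
     (\<forall>z\<in>U. J z \<noteq> {}) \<and>
     (\<forall>z\<in>U. \<exists>r>0. \<exists>B. \<forall>y \<in> ball z r \<inter> U. \<forall>V \<in> J y. norm V \<le> B) \<and>
     closedin (top_of_set (U \<times> UNIV)) {(z, V). z \<in> U \<and> V \<in> J z} \<and>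
     (\<forall>\<mu>. abs_continuous_on {0..1} \<mu> \<and> \<mu> ` {0..1} \<subseteq> U \<longrightarrow>
        (AE t in lebesgue. t \<in> {0..1} \<longrightarrow>
           (\<exists>v. (\<mu> has_vector_derivative v) (at t within {0..1}) \<and>
              (\<forall>V \<in> J (\<mu> t).
                 ((\<lambda>s. G (\<mu> s)) has_vector_derivative V *v v) (at t within {0..1})))))"


section \<open>The parametric problem\<close>

text \<open>
  The objective is \<open>f x \<theta>\<close>; only its values for \<open>\<theta> \<in> \<Theta>\<close> are used.
\<close>

definition grad :: "('a::real_inner \<Rightarrow> real) \<Rightarrow> 'a \<Rightarrow> 'a" where
  "grad g x = (THE D. GDERIV g x :> D)"

definition grad_x ::
  "(real ^ 'n \<Rightarrow> real ^ 'm \<Rightarrow> real) \<Rightarrow> real ^ ('n::finite + 'm::finite) \<Rightarrow> real ^ 'n" where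
  "grad_x f z = grad (\<lambda>x. f x (vsnd z)) (vfst z)"

definition C11 :: "('a::real_inner \<Rightarrow> real) \<Rightarrow> bool" where
  "C11 g \<longleftrightarrow> (\<forall>x. \<exists>D. GDERIV g x :> D) \<and> (\<exists>L. L-lipschitz_on UNIV (grad g))"

definition sol_set :: "(real ^ 'n \<Rightarrow> real ^ 'm \<Rightarrow> real) \<Rightarrow> real ^ 'm \<Rightarrow> (real ^ 'n) set" where
  "sol_set f \<theta> = {x. is_arg_min (\<lambda>x. f x \<theta>) (\<lambda>_. True) x}"

definition regular_problem ::
  "(real ^ 'm) set \<Rightarrow> (real ^ 'n \<Rightarrow> real ^ 'm \<Rightarrow> real) \<Rightarrow> bool" where
  "regular_problem \<Theta> f \<longleftrightarrow>
     (\<forall>\<theta>\<in>\<Theta>. C11 (\<lambda>x. f x \<theta>) \<and> convex_on UNIV (\<lambda>x. f x \<theta>) \<and> sol_set f \<theta> \<noteq> {}) \<and>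
     locally_lipschitz_on {z. vsnd z \<in> \<Theta>} (grad_x f)"

definition x_min :: "(real ^ 'n \<Rightarrow> real ^ 'm \<Rightarrow> real) \<Rightarrow> real ^ 'm \<Rightarrow> real ^ 'n" where
  "x_min f \<theta> = (THE x. is_arg_min norm (\<lambda>x. x \<in> sol_set f \<theta>) x)"

definition x_reg :: "(real ^ 'n \<Rightarrow> real ^ 'm \<Rightarrow> real) \<Rightarrow> real \<Rightarrow> real ^ 'm \<Rightarrow> real ^ 'n" where
  "x_reg f \<epsilon> \<theta> = (THE x. is_arg_min (\<lambda>x. f x \<theta> + \<epsilon> / 2 * (norm x)\<^sup>2) (\<lambda>_. True) x)"

definition uniform_range_condition ::
  "(real ^ 'n \<Rightarrow> real ^ 'm \<Rightarrow> real) \<Rightarrow> (real ^ 'm) set \<Rightarrow> real \<Rightarrow>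
   (real ^ ('n::finite + 'm::finite) \<Rightarrow> (real ^ ('n::finite + 'm::finite) ^ 'n) set) \<Rightarrow> bool" where
  "uniform_range_condition f \<O> \<epsilon>bar J \<longleftrightarrow>
     (\<forall>K. compact K \<and> K \<subseteq> \<O> \<longrightarrow>
        (\<exists>C>0. \<forall>\<theta>\<in>K. \<forall>\<epsilon>. 0 < \<epsilon> \<and> \<epsilon> \<le> \<epsilon>bar \<longrightarrow>
           (\<forall>H M. hcat H M \<in> J (vconcat (x_reg f \<epsilon> \<theta>) \<theta>) \<longrightarrow>
              sym_psd H \<and> (\<exists>W. M = H ** W \<and> onorm ((*v) W) \<le> C))))"

definition J_reg ::
  "(real ^ 'n \<Rightarrow> real ^ 'm \<Rightarrow> real) \<Rightarrow>
   (real ^ ('n::finite + 'm::finite) \<Rightarrow> (real ^ ('n::finite + 'm::finite) ^ 'n) set) \<Rightarrow>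
   real \<Rightarrow> real ^ 'm \<Rightarrow> (real ^ 'm ^ 'n) set" where
  "J_reg f J \<epsilon> \<theta> =
     {- (matrix_inv (H + \<epsilon> *\<^sub>R mat 1) ** M) |H M. hcat H M \<in> J (vconcat (x_reg f \<epsilon> \<theta>) \<theta>)}"

text \<open>
  Below, \<open>\<epsilon>\<^sub>k \<down> 0\<close> is read as \<open>\<epsilon>\<^sub>k > 0\<close> and \<open>\<epsilon>\<^sub>k \<longlonglongrightarrow> 0\<close>; by passing to subsequences, requiring
  monotonicity in addition would give the same sets. Limits of matrices are in the Frobenius
  norm, which induces the same topology as the operator norm.
\<close>

definition J_min ::
  "(real ^ 'n \<Rightarrow> real ^ 'm \<Rightarrow> real) \<Rightarrow> (real ^ 'm) set \<Rightarrow> real \<Rightarrow>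
   (real ^ ('n::finite + 'm::finite) \<Rightarrow> (real ^ ('n::finite + 'm::finite) ^ 'n) set) \<Rightarrow>
   real ^ 'm \<Rightarrow> (real ^ 'm ^ 'n) set" where
  "J_min f \<O> \<epsilon>bar J \<theta> =
     {V. \<exists>\<theta>s \<epsilon>s Vs.
        (\<forall>k::nat. \<theta>s k \<in> \<O> \<and> 0 < \<epsilon>s k \<and> \<epsilon>s k \<le> \<epsilon>bar \<and> Vs k \<in> J_reg f J (\<epsilon>s k) (\<theta>s k)) \<and>
        \<theta>s \<longlonglongrightarrow> \<theta> \<and> \<epsilon>s \<longlonglongrightarrow> 0 \<and> Vs \<longlonglongrightarrow> V \<and>
        (\<lambda>k. x_reg f (\<epsilon>s k) (\<theta>s k)) \<longlonglongrightarrow> x_min f \<theta>}"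

definition reachable ::
  "(real ^ 'n \<Rightarrow> real ^ 'm \<Rightarrow> real) \<Rightarrow>
   (real ^ ('n::finite + 'm::finite) \<Rightarrow> (real ^ ('n::finite + 'm::finite) ^ 'n) set) \<Rightarrow>
   real ^ 'm \<Rightarrow> (real ^ ('n::finite + 'm::finite) ^ 'n) set" where
  "reachable f J \<theta> =
     {A \<in> J (vconcat (x_min f \<theta>) \<theta>). \<exists>\<epsilon>s As.
        (\<forall>k::nat. 0 < \<epsilon>s k \<and> As k \<in> J (vconcat (x_reg f (\<epsilon>s k) \<theta>) \<theta>)) \<and>
        \<epsilon>s \<longlonglongrightarrow> 0 \<and> As \<longlonglongrightarrow> A}"

end

theory Submission
  imports Defs
begin

text \<open>
  Tikhonov regularization selects the minimal norm solution in the limit, so \<open>(H\<^sub>k M\<^sub>k)\<close> is bounded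
  by local boundedness of the conservative Jacobian, and its limit points lie in the reachable set
  by closedness of the graph. The range condition \<open>M\<^sub>k = H\<^sub>k W\<close> turns \<open>W\<^sub>k\<close> into an orthogonal
  projection of \<open>W\<close>, which bounds \<open>W\<^sub>k\<close>, while \<open>0 \<preceq> R\<^sub>k \<preceq> I\<close> bounds \<open>R\<^sub>k\<close>. Passing to the limit in
  \<open>(H\<^sub>k + \<epsilon>\<^sub>k I) R\<^sub>k = H\<^sub>k = R\<^sub>k (H\<^sub>k + \<epsilon>\<^sub>k I)\<close> gives \<open>H R = H = R H\<close>. Hence \<open>R\<close> is the identity on the
  range of \<open>H\<close> and preserves \<open>ker H\<close>, so \<open>R - H\<^sup>\<dagger> H\<close> is its compression to \<open>ker H\<close>.
\<close>

section \<open>Matrices\<close>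

lemma matrix_diff_ldistrib:
  fixes A :: "real ^ 'n ^ 'm" and B C :: "real ^ 'k ^ 'n"
  shows "A ** (B - C) = A ** B - A ** C"
  by (simp add: matrix_matrix_mult_def vec_eq_iff right_diff_distrib sum_subtractf)

lemma matrix_diff_rdistrib:
  fixes A B :: "real ^ 'n ^ 'm" and C :: "real ^ 'k ^ 'n"
  shows "(A - B) ** C = A ** C - B ** C"
  by (simp add: matrix_matrix_mult_def vec_eq_iff left_diff_distrib sum_subtractf)

lemma matrix_add_rdistrib_real:
  fixes A B :: "real ^ 'n ^ 'm" and C :: "real ^ 'k ^ 'n"
  shows "(A + B) ** C = A ** C + B ** C"
  by (simp add: matrix_matrix_mult_def vec_eq_iff distrib_right sum.distrib)

lemma matrix_mult_uminus:
  fixes A :: "real ^ 'n ^ 'm" and B :: "real ^ 'k ^ 'n"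
  shows "A ** (- B) = - (A ** B)"
  by (simp add: matrix_matrix_mult_def vec_eq_iff sum_negf)

lemma matrix_mult_scaleR:
  fixes A :: "real ^ 'n ^ 'm" and B :: "real ^ 'k ^ 'n"
  shows "A ** (c *\<^sub>R B) = c *\<^sub>R (A ** B)" "(c *\<^sub>R A) ** B = c *\<^sub>R (A ** B)"
  by (simp_all add: matrix_matrix_mult_def vec_eq_iff sum_distrib_left mult_ac)

lemma transpose_add_diff:
  fixes A B :: "real ^ 'n ^ 'm"
  shows "transpose (A + B) = transpose A + transpose B"
    "transpose (A - B) = transpose A - transpose B"
  by (simp_all add: transpose_def vec_eq_iff)

lemma inner_symmetric_matrix:
  fixes A :: "real ^ 'n ^ 'n"
  assumes "transpose A = A"
  shows "(A *v x) \<bullet> y = x \<bullet> (A *v y)"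
  by (metis assms dot_lmul_matrix transpose_matrix_vector)

lemma symmetric_matrixI:
  fixes A :: "real ^ 'n ^ 'n"
  assumes "\<And>x y. (A *v x) \<bullet> y = x \<bullet> (A *v y)"
  shows "transpose A = A"
proof -
  have "transpose A *v x = A *v x" for x
    by (rule vector_eq_rdot[THEN iffD1]) (simp add: assms dot_lmul_matrix)
  then show ?thesis
    using matrix_eq by blast
qed

section \<open>Limits and bounds for sequences of matrices\<close>

lemma tendsto_matrix_mult:
  fixes A :: "'a \<Rightarrow> real ^ 'n ^ 'm" and B :: "'a \<Rightarrow> real ^ 'k ^ 'n"
  assumes "(A \<longlongrightarrow> a) F" "(B \<longlongrightarrow> b) F"
  shows "((\<lambda>x. A x ** B x) \<longlongrightarrow> a ** b) F"
  unfolding matrix_matrix_mult_def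
  by (intro tendsto_vec_lambda tendsto_sum tendsto_mult tendsto_vec_nth assms)

lemma tendsto_matrix_vector_mult:
  fixes A :: "'a \<Rightarrow> real ^ 'n ^ 'm"
  assumes "(A \<longlongrightarrow> a) F"
  shows "((\<lambda>k. A k *v x) \<longlongrightarrow> a *v x) F"
  unfolding matrix_vector_mult_def
  by (intro tendsto_vec_lambda tendsto_sum tendsto_mult tendsto_vec_nth assms tendsto_const)

lemma tendsto_transpose:
  fixes A :: "'a \<Rightarrow> real ^ 'n ^ 'm"
  assumes "(A \<longlongrightarrow> a) F"
  shows "((\<lambda>k. transpose (A k)) \<longlongrightarrow> transpose a) F"
  unfolding transpose_def by (intro tendsto_vec_lambda tendsto_vec_nth assms)

lemma sym_psd_tendsto:
  fixes A :: "nat \<Rightarrow> real ^ 'n ^ 'n"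
  assumes "A \<longlonglongrightarrow> a" "\<And>k. sym_psd (A k)"
  shows "sym_psd a"
proof -
  have "(\<lambda>k. transpose (A k)) \<longlonglongrightarrow> transpose a"
    by (rule tendsto_transpose[OF assms(1)])
  then have "transpose a = a"
    using assms by (auto simp: sym_psd_def intro: LIMSEQ_unique)
  moreover have "0 \<le> x \<bullet> (a *v x)" for x
  proof (rule LIMSEQ_le_const)
    show "(\<lambda>k. x \<bullet> (A k *v x)) \<longlonglongrightarrow> x \<bullet> (a *v x)"
      by (intro tendsto_inner tendsto_const tendsto_matrix_vector_mult assms)
  qed (use assms(2) in \<open>auto simp: sym_psd_def\<close>)
  ultimately show ?thesis
    by (simp add: sym_psd_def)
qed

text \<open>The range condition controls operator norms, while \<open>bounded\<close> refers to the
  Frobenius norm. The latter is at most the sum of the absolute entries, and each entry is at most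
  the operator norm.\<close>

lemma bounded_range_onorm:
  fixes A :: "'a \<Rightarrow> real ^ 'n ^ 'm"
  assumes "\<And>k. onorm ((*v) (A k)) \<le> C"
  shows "bounded (range A)"
proof -
  have "norm (A k) \<le> (\<Sum>i\<in>(UNIV::'m set). \<Sum>j\<in>(UNIV::'n set). C)" for k
  proof -
    have "norm (A k) \<le> (\<Sum>i\<in>UNIV. norm (A k $ i))"
      unfolding norm_vec_def[of "A k"] by (rule L2_set_le_sum) simp
    also have "\<dots> \<le> (\<Sum>i\<in>UNIV. \<Sum>j\<in>UNIV. \<bar>A k $ i $ j\<bar>)"
      by (intro sum_mono norm_le_l1_cart)
    also have "\<dots> \<le> (\<Sum>i\<in>(UNIV::'m set). \<Sum>j\<in>(UNIV::'n set). C)"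
      by (intro sum_mono order_trans[OF matrix_component_le_onorm assms])
    finally show ?thesis .
  qed
  then show ?thesis
    by (auto simp: bounded_iff)
qed

text \<open>Serves two contractions: the complementary projector that produces \<open>W k\<close>,
  and \<open>R k\<close> in the bound on \<open>V k\<close>.\<close>

lemma onorm_matrix_mult:
  fixes A :: "real ^ 'n ^ 'm" and B :: "real ^ 'k ^ 'n"
  assumes "\<And>x. norm (A *v x) \<le> norm x"
  shows "onorm ((*v) (A ** B)) \<le> onorm ((*v) B)"
proof (rule onorm_le)
  fix x
  have "norm (A *v (B *v x)) \<le> norm (B *v x)"
    by (rule assms)
  also have "\<dots> \<le> onorm ((*v) B) * norm x"
    by (rule onorm) simp
  finally show "norm (A ** B *v x) \<le> onorm ((*v) B) * norm x"
    by (simp add: matrix_vector_mul_assoc)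
qed


section \<open>Orthogonal projectors and pseudoinverses\<close>

lemma ker_subspace: "subspace (ker A)"
  by (auto simp: subspace_def ker_def algebra_simps)

text \<open>The vector \<open>y - y'\<close> lies in \<open>E\<close>, and as a difference of
  \<open>x - y'\<close> and \<open>x - y\<close> it also lies in the orthogonal complement, so it is
  orthogonal to itself.\<close>

lemma orthogonal_decomposition_unique:
  fixes E :: "(real ^ 'n) set"
  assumes "subspace E" "y \<in> E" "y' \<in> E" "x - y \<in> E\<^sup>\<bottom>" "x - y' \<in> E\<^sup>\<bottom>"
  shows "y = y'"
proof -
  have "y - y' \<in> E"
    using assms by (simp add: subspace_diff)
  then have "(y - y') \<bullet> (x - y') = 0" "(y - y') \<bullet> (x - y) = 0"
    using assms by (auto simp: orthogonal_comp_def orthogonal_def)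
  then have "(y - y') \<bullet> (y - y') = 0"
    by (simp add: inner_diff_right)
  then show ?thesis
    by simp
qed

text \<open>Justifies the definite description in \<open>proj_mat\<close>. A component in
  \<open>E\<close> is chosen for each vector; uniqueness of the decomposition makes this choice
  linear, hence a matrix, and makes that matrix unique.\<close>

lemma proj_mat:
  fixes E :: "(real ^ 'n) set"
  assumes E: "subspace E"
  shows "proj_mat E *v x \<in> E" "x - proj_mat E *v x \<in> E\<^sup>\<bottom>"
proof -
  have "\<exists>y. y \<in> E \<and> x - y \<in> E\<^sup>\<bottom>" for x
  proof -
    obtain y z where "y \<in> span E" "\<And>w. w \<in> span E \<Longrightarrow> orthogonal z w" "x = y + z"
      using orthogonal_subspace_decomp_exists by blast
    then show ?thesis
      using E by (intro exI[of _ y])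
        (auto simp: orthogonal_comp_def orthogonal_commute span_eq_iff[THEN iffD2])
  qed
  then obtain p where p: "p x \<in> E" "x - p x \<in> E\<^sup>\<bottom>" for x
    by metis
  have "linear p"
  proof
    fix x y
    have "(x + y) - (p x + p y) = (x - p x) + (y - p y)"
      by simp
    then have "(x + y) - (p x + p y) \<in> E\<^sup>\<bottom>"
      using p subspace_add[OF subspace_orthogonal_comp] by metis
    then show "p (x + y) = p x + p y"
      by (intro orthogonal_decomposition_unique[OF E]) (auto intro: p subspace_add[OF E])
  next
    fix c x
    have "c *\<^sub>R x - c *\<^sub>R p x \<in> E\<^sup>\<bottom>"
      using p(2)[of x] subspace_scale[OF subspace_orthogonal_comp] by (metis scaleR_diff_right)
    then show "p (c *\<^sub>R x) = c *\<^sub>R p x"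
      by (intro orthogonal_decomposition_unique[OF E]) (auto intro: p subspace_scale[OF E])
  qed
  then have ex: "\<forall>x. matrix p *v x \<in> E \<and> x - matrix p *v x \<in> E\<^sup>\<bottom>"
    using p by (simp add: matrix_works)
  have "\<forall>x. proj_mat E *v x \<in> E \<and> x - proj_mat E *v x \<in> E\<^sup>\<bottom>"
    unfolding proj_mat_def
  proof (rule theI)
    show "\<forall>x. matrix p *v x \<in> E \<and> x - matrix p *v x \<in> E\<^sup>\<bottom>"
      by (rule ex)
    fix Q :: "real ^ 'n ^ 'n"
    assume "\<forall>x. Q *v x \<in> E \<and> x - Q *v x \<in> E\<^sup>\<bottom>"
    then show "Q = matrix p"
      using ex by (auto simp: matrix_eq intro: orthogonal_decomposition_unique[OF E])
  qed
  then show "proj_mat E *v x \<in> E" "x - proj_mat E *v x \<in> E\<^sup>\<bottom>"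
    by auto
qed

lemma proj_mat_fixes:
  fixes E :: "(real ^ 'n) set"
  assumes "subspace E" "x \<in> E"
  shows "proj_mat E *v x = x"
  using assms proj_mat[OF assms(1), of x]
  by (intro orthogonal_decomposition_unique[OF assms(1)])
    (auto simp: subspace_0[OF subspace_orthogonal_comp])

lemma proj_mat_idempotent:
  fixes E :: "(real ^ 'n) set"
  assumes "subspace E"
  shows "proj_mat E ** proj_mat E = proj_mat E"
  by (simp add: matrix_eq proj_mat proj_mat_fixes assms flip: matrix_vector_mul_assoc)

text \<open>The residual of \<open>y\<close> is orthogonal to \<open>E\<close>. The right-hand side
  is symmetric in \<open>x\<close> and \<open>y\<close>, which is how the projector is shown to be
  symmetric.\<close>

lemma inner_proj_mat:
  fixes E :: "(real ^ 'n) set"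
  assumes "subspace E"
  shows "(proj_mat E *v x) \<bullet> y = (proj_mat E *v x) \<bullet> (proj_mat E *v y)"
  using proj_mat(1)[OF assms, of x] proj_mat(2)[OF assms, of y]
  by (auto simp: orthogonal_comp_def orthogonal_def inner_diff_right)

lemma transpose_proj_mat:
  fixes E :: "(real ^ 'n) set"
  assumes "subspace E"
  shows "transpose (proj_mat E) = proj_mat E"
  by (intro symmetric_matrixI) (metis assms inner_commute inner_proj_mat)

text \<open>Pythagoras: the two squared norms differ by the squared norm of the projection.\<close>

lemma norm_mat_1_diff_proj_mat:
  fixes E :: "(real ^ 'n) set"
  assumes "subspace E"
  shows "norm ((mat 1 - proj_mat E) *v x) \<le> norm x"
proof (rule power2_le_imp_le)
  have "(norm x)\<^sup>2 - (norm ((mat 1 - proj_mat E) *v x))\<^sup>2 = (norm (proj_mat E *v x))\<^sup>2"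
    using inner_proj_mat[OF assms, of x x]
    by (simp add: power2_norm_eq_inner algebra_simps inner_commute)
  then show "(norm ((mat 1 - proj_mat E) *v x))\<^sup>2 \<le> (norm x)\<^sup>2"
    by (smt (verit) zero_le_power2)
qed simp

lemma symmetric_mult_proj_ker:
  fixes H :: "real ^ 'n ^ 'n"
  assumes "transpose H = H"
  shows "H ** proj_mat (ker H) = 0" "proj_mat (ker H) ** H = 0"
proof -
  show *: "H ** proj_mat (ker H) = 0"
    using proj_mat(1)[OF ker_subspace[of H]]
    by (simp add: matrix_eq ker_def flip: matrix_vector_mul_assoc)
  have "transpose (H ** proj_mat (ker H)) = proj_mat (ker H) ** H"
    by (simp add: matrix_transpose_mul assms transpose_proj_mat ker_subspace)
  then show "proj_mat (ker H) ** H = 0"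
    unfolding * by (simp add: transpose_def vec_eq_iff)
qed

text \<open>From \<open>A ** Y ** A = A\<close> comes \<open>A ** X = (A ** Y) ** (A ** X)\<close>;
  transposing this product of symmetric matrices swaps the factors and leaves \<open>A ** Y\<close>.
  The mirrored argument gives \<open>X ** A = Y ** A\<close>, and \<open>X = X ** A ** X\<close>
  then turns into \<open>Y\<close>.\<close>

lemma penrose_inverse_unique:
  fixes A :: "real ^ 'n ^ 'm"
  assumes X: "penrose_inverse A X" and Y: "penrose_inverse A Y"
  shows "X = Y"
proof -
  have "A ** X = transpose ((A ** Y) ** (A ** X))"
    using X Y by (metis matrix_mul_assoc penrose_inverse_def)
  also have "\<dots> = (A ** X) ** (A ** Y)"
    using X Y by (simp add: matrix_transpose_mul[of "A ** Y"] penrose_inverse_def)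
  also have "\<dots> = A ** Y"
    using X by (metis matrix_mul_assoc penrose_inverse_def)
  finally have 1: "A ** X = A ** Y" .
  have "X ** A = transpose ((X ** A) ** (Y ** A))"
    using X Y by (metis matrix_mul_assoc penrose_inverse_def)
  also have "\<dots> = (Y ** A) ** (X ** A)"
    using X Y by (simp add: matrix_transpose_mul[of "X ** A"] penrose_inverse_def)
  also have "\<dots> = Y ** A"
    using X by (metis matrix_mul_assoc penrose_inverse_def)
  finally have 2: "X ** A = Y ** A" .
  have "X = X ** A ** X"
    using X by (simp add: penrose_inverse_def)
  also have "\<dots> = Y ** A ** Y"
    by (metis 1 2 matrix_mul_assoc)
  also have "\<dots> = Y"
    using Y by (simp add: penrose_inverse_def)
  finally show ?thesis .
qed

lemma matrix_inv_if_injective: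
  fixes A :: "real ^ 'n ^ 'n"
  assumes "\<And>x. A *v x = 0 \<Longrightarrow> x = 0"
  shows "A ** matrix_inv A = mat 1" "matrix_inv A ** A = mat 1"
proof -
  have "invertible A"
    using assms matrix_left_invertible_ker[of A] by (auto simp: invertible_left_inverse)
  then have "\<exists>B. A ** B = mat 1 \<and> B ** A = mat 1"
    by (simp add: invertible_def)
  then show "A ** matrix_inv A = mat 1" "matrix_inv A ** A = mat 1"
    unfolding matrix_inv_def by (metis (mono_tags, lifting) someI_ex)+
qed

text \<open>For symmetric \<open>H\<close>, with \<open>P\<close> the projector onto \<open>ker H\<close>, the matrix \<open>H + P\<close> is invertible
  and \<open>(H + P)\<^sup>-\<^sup>1 - P\<close> is the pseudoinverse.\<close>

lemma pinv_symmetric: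
  fixes H :: "real ^ 'n ^ 'n"
  assumes H: "transpose H = H"
  shows "pinv H ** H = mat 1 - proj_mat (ker H)" "H ** pinv H = mat 1 - proj_mat (ker H)"
proof -
  define P where "P = proj_mat (ker H)"
  define Q where "Q = matrix_inv (H + P)"
  have PP: "P ** P = P" and HP: "H ** P = 0" and PH: "P ** H = 0" and tP: "transpose P = P"
    using symmetric_mult_proj_ker[OF H]
    by (simp_all add: P_def proj_mat_idempotent transpose_proj_mat ker_subspace)
  have inj: "x = 0" if "(H + P) *v x = 0" for x
  proof -
    have "P *v ((H + P) *v x) = P *v x"
      by (simp add: matrix_vector_mul_assoc matrix_add_ldistrib PH PP)
    then have Px: "P *v x = 0"
      using that by simp
    then have "H *v x = 0"
      using that by (simp add: matrix_vector_mult_add_rdistrib)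
    then have "P *v x = x"
      using proj_mat_fixes[OF ker_subspace, of x H] by (simp add: P_def ker_def)
    then show ?thesis
      using Px by simp
  qed
  have NQ: "(H + P) ** Q = mat 1" and QN: "Q ** (H + P) = mat 1"
    unfolding Q_def using matrix_inv_if_injective[of "H + P"] inj by blast+
  \<comment> \<open>The matrix \<open>H + P\<close> leaves \<open>P\<close> unchanged under
    multiplication from either side, so its inverse does too.\<close>
  have QP: "Q ** P = P"
  proof -
    have "Q ** P = Q ** ((H + P) ** P)"
      by (simp add: matrix_add_rdistrib_real HP PP)
    then show ?thesis
      by (simp add: matrix_mul_assoc QN)
  qed
  have PQ: "P ** Q = P"
  proof -
    have "P ** Q = (P ** (H + P)) ** Q"
      by (simp add: matrix_add_ldistrib PH PP)
    then show ?thesis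
      by (simp add: NQ flip: matrix_mul_assoc)
  qed
  have HQ: "H ** Q = mat 1 - P"
    using NQ by (simp add: matrix_add_rdistrib_real PQ eq_diff_eq)
  have QH: "Q ** H = mat 1 - P"
    using QN by (simp add: matrix_add_ldistrib QP eq_diff_eq)
  have HX: "H ** (Q - P) = mat 1 - P" and XH: "(Q - P) ** H = mat 1 - P"
    by (simp_all add: matrix_diff_ldistrib matrix_diff_rdistrib HQ QH HP PH)
  have "penrose_inverse H (Q - P)"
    unfolding penrose_inverse_def HX XH
    by (simp add: matrix_diff_ldistrib matrix_diff_rdistrib PH PQ PP tP transpose_add_diff)
  then have "pinv H = Q - P"
    unfolding pinv_def using penrose_inverse_unique by blast
  then show "pinv H ** H = mat 1 - proj_mat (ker H)" "H ** pinv H = mat 1 - proj_mat (ker H)"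
    using HX XH by (simp_all add: P_def)
qed

text \<open>\<open>H ** pinv H\<close> removes only the component in \<open>ker H\<close>, which a
  symmetric \<open>H\<close> does not have in its range. Thus any factorization
  \<open>M = H ** A\<close> may be replaced by the one through \<open>pinv H ** M\<close>.\<close>

lemma mult_pinv_range:
  fixes H :: "real ^ 'n ^ 'n" and A :: "real ^ 'm ^ 'n"
  assumes "transpose H = H"
  shows "H ** (pinv H ** (H ** A)) = H ** A"
proof -
  have "H ** pinv H ** H = H"
    by (simp add: pinv_symmetric[OF assms] matrix_diff_rdistrib symmetric_mult_proj_ker[OF assms])
  then show ?thesis
    by (simp add: matrix_mul_assoc)
qed


section \<open>Regularized inverses of positive semidefinite matrices\<close>

text \<open>The quadratic form of the shifted matrix is at least \<open>e * (x \<bullet> x)\<close>,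
  so its kernel is trivial.\<close>

lemma sym_psd_regularized_inverse:
  fixes H :: "real ^ 'n ^ 'n"
  assumes H: "sym_psd H" and e: "0 < e"
  shows "(H + e *\<^sub>R mat 1) ** matrix_inv (H + e *\<^sub>R mat 1) = mat 1"
    "matrix_inv (H + e *\<^sub>R mat 1) ** (H + e *\<^sub>R mat 1) = mat 1"
proof -
  have inj: "x = 0" if "(H + e *\<^sub>R mat 1) *v x = 0" for x
  proof -
    have "x \<bullet> ((H + e *\<^sub>R mat 1) *v x) = x \<bullet> (H *v x) + e * (x \<bullet> x)"
      by (simp add: matrix_vector_mult_add_rdistrib inner_add_right flip: scaleR_matrix_vector_assoc)
    moreover have "0 \<le> x \<bullet> (H *v x)"
      using H by (simp add: sym_psd_def)
    ultimately have "e * (x \<bullet> x) \<le> 0"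
      using that by simp
    then show ?thesis
      using e by (simp add: mult_le_0_iff flip: power2_norm_eq_inner)
  qed
  show "(H + e *\<^sub>R mat 1) ** matrix_inv (H + e *\<^sub>R mat 1) = mat 1"
    "matrix_inv (H + e *\<^sub>R mat 1) ** (H + e *\<^sub>R mat 1) = mat 1"
    using matrix_inv_if_injective[of "H + e *\<^sub>R mat 1"] inj by blast+
qed

text \<open>The conclusions speak only of \<open>H\<close>, \<open>e\<close> and \<open>R\<close>,
  because the inverse itself may blow up as \<open>e\<close> tends to 0, whereas these relations
  pass to the limit.\<close>

lemma regularized_inverse_mult:
  fixes H :: "real ^ 'n ^ 'n"
  assumes H: "sym_psd H" and e: "0 < e"
  defines "R \<equiv> matrix_inv (H + e *\<^sub>R mat 1) ** H"
  shows "H ** R + e *\<^sub>R R = H" "R ** H + e *\<^sub>R R = H"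
    "sym_psd R" "sym_psd (mat 1 - R)" "norm (R *v x) \<le> norm x"
proof -
  define N where "N = H + e *\<^sub>R mat 1"
  define G where "G = matrix_inv N"
  have NG: "N ** G = mat 1" and GN: "G ** N = mat 1"
    using sym_psd_regularized_inverse[OF H e] by (simp_all add: N_def G_def)
  have tH: "transpose H = H" and psd: "0 \<le> z \<bullet> (H *v z)" for z
    using H by (auto simp: sym_psd_def)
  have tN: "transpose N = N"
    by (simp add: N_def transpose_add_diff transpose_scalar tH)
  have tG: "transpose G = G"
  proof -
    have "transpose G ** N = mat 1"
      by (metis NG matrix_transpose_mul tN transpose_mat)
    then have "transpose G ** (N ** G) = G"
      by (simp add: matrix_mul_assoc)
    then show ?thesis
      by (simp add: NG)
  qed
  have GH: "G ** H + e *\<^sub>R G = mat 1"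
    using GN by (simp add: N_def matrix_add_ldistrib matrix_mult_scaleR)
  have HG: "H ** G + e *\<^sub>R G = mat 1"
    using NG by (simp add: N_def matrix_add_rdistrib_real matrix_mult_scaleR)
  have R: "R = G ** H"
    by (simp add: R_def G_def N_def)
  \<comment> \<open>\<open>H\<close> commutes with \<open>G\<close>, since both products equal
    \<open>mat 1 - e *\<^sub>R G\<close>.\<close>
  have R': "R = H ** G"
    using GH HG unfolding R by (metis add_right_imp_eq)
  show "H ** R + e *\<^sub>R R = H"
  proof -
    have "H ** R + e *\<^sub>R R = H ** (G ** H + e *\<^sub>R G)"
      by (subst (2) R') (simp add: R matrix_add_ldistrib matrix_mult_scaleR)
    then show ?thesis
      by (simp add: GH)
  qed
  show "R ** H + e *\<^sub>R R = H"
  proof -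
    have "R ** H + e *\<^sub>R R = (H ** G + e *\<^sub>R G) ** H"
      by (subst (2) R) (simp add: R' matrix_add_rdistrib_real matrix_mult_scaleR)
    then show ?thesis
      by (simp add: HG)
  qed
  have N_psd: "0 \<le> z \<bullet> (N *v z)" for z
    using psd[of z] e
    by (simp add: N_def matrix_vector_mult_add_rdistrib inner_add_right
        flip: scaleR_matrix_vector_assoc)
  have G_psd: "sym_psd G"
    unfolding sym_psd_def
  proof (intro conjI allI tG)
    fix x
    have "(G *v x) \<bullet> (N *v (G *v x)) = (G *v x) \<bullet> x"
      by (simp add: matrix_vector_mul_assoc NG)
    then show "0 \<le> x \<bullet> (G *v x)"
      using N_psd[of "G *v x"] by (simp add: inner_commute)
  qed
  \<comment> \<open>Expressing \<open>x\<close> through \<open>G *v x\<close> turns positivity of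
    \<open>R\<close> and its norm bound into sums of nonnegative terms, without
    diagonalization.\<close>
  have z: "R *v x = H *v (G *v x)" "x = H *v (G *v x) + e *\<^sub>R (G *v x)" for x
  proof -
    show "R *v x = H *v (G *v x)"
      by (simp add: R' matrix_vector_mul_assoc)
    have "(H ** G + e *\<^sub>R G) *v x = x"
      by (simp add: HG)
    then show "x = H *v (G *v x) + e *\<^sub>R (G *v x)"
      by (simp add: matrix_vector_mult_add_rdistrib matrix_vector_mul_assoc
          scaleR_matrix_vector_assoc)
  qed
  show "sym_psd R"
    unfolding sym_psd_def
  proof (intro conjI allI)
    show "transpose R = R"
      by (metis R R' matrix_transpose_mul tG tH)
    fix x
    let ?z = "G *v x"
    have "x \<bullet> (R *v x) = (H *v ?z + e *\<^sub>R ?z) \<bullet> (H *v ?z)"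
      using z by metis
    also have "\<dots> = (H *v ?z) \<bullet> (H *v ?z) + e * (?z \<bullet> (H *v ?z))"
      by (simp add: inner_add_left)
    finally show "0 \<le> x \<bullet> (R *v x)"
      using psd[of ?z] e by simp
  qed
  have "mat 1 - R = e *\<^sub>R G"
    using GH by (simp add: R algebra_simps)
  then show "sym_psd (mat 1 - R)"
    using G_psd e by (simp add: sym_psd_def transpose_scalar flip: scaleR_matrix_vector_assoc)
  show "norm (R *v x) \<le> norm x"
  proof (rule power2_le_imp_le)
    let ?z = "G *v x"
    have "(norm x)\<^sup>2 = (H *v ?z + e *\<^sub>R ?z) \<bullet> (H *v ?z + e *\<^sub>R ?z)"
      using z(2)[of x] by (simp add: power2_norm_eq_inner)
    also have "\<dots> = (norm (R *v x))\<^sup>2 + 2 * e * (?z \<bullet> (H *v ?z)) + e\<^sup>2 * (norm ?z)\<^sup>2"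
      unfolding power2_norm_eq_inner
      by (simp add: z(1) inner_add_left inner_add_right inner_commute power2_eq_square)
    finally show "(norm (R *v x))\<^sup>2 \<le> (norm x)\<^sup>2"
      using psd[of ?z] e by simp
  qed simp
qed

text \<open>An eigenvalue \<open>\<lambda>\<close> of \<open>H k\<close> becomes
  \<open>\<lambda> / (\<lambda> + \<epsilon> k)\<close> in \<open>R k\<close>. This tends to 1 if
  \<open>\<lambda>\<close> stays away from 0; if \<open>\<lambda>\<close> tends to 0, the outcome
  depends on its ratio to \<open>\<epsilon> k\<close>. The matrix \<open>S\<close> records that
  second part, which lives on \<open>ker h\<close>.\<close>

lemma spectral_remainder_limit:
  fixes H R :: "nat \<Rightarrow> real ^ 'n ^ 'n"
  assumes H: "\<And>k. sym_psd (H k)" and e: "\<And>k. 0 < \<epsilon> k" "\<epsilon> \<longlonglongrightarrow> 0"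
    and R: "\<And>k. R k = matrix_inv (H k + \<epsilon> k *\<^sub>R mat 1) ** H k"
    and lim: "H \<longlonglongrightarrow> h" "R \<longlonglongrightarrow> r"
  defines "S \<equiv> r - pinv h ** h" and "P \<equiv> proj_mat (ker h)"
  shows "h ** r = h" "S = P ** r ** P" "0 \<preceq>\<^sub>L S" "S \<preceq>\<^sub>L P"
proof -
  have Rk: "H k ** R k + \<epsilon> k *\<^sub>R R k = H k" "R k ** H k + \<epsilon> k *\<^sub>R R k = H k"
    "sym_psd (R k)" "sym_psd (mat 1 - R k)" for k
    using regularized_inverse_mult[OF H[of k] e(1)[of k]] by (simp_all add: R)
  have "(\<lambda>k. H k ** R k + \<epsilon> k *\<^sub>R R k) \<longlonglongrightarrow> h ** r + 0 *\<^sub>R r"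
    by (intro tendsto_intros tendsto_matrix_mult lim e)
  then show hr: "h ** r = h"
    unfolding Rk using lim(1) LIMSEQ_unique by fastforce
  have "(\<lambda>k. R k ** H k + \<epsilon> k *\<^sub>R R k) \<longlonglongrightarrow> r ** h + 0 *\<^sub>R r"
    by (intro tendsto_intros tendsto_matrix_mult lim e)
  then have rh: "r ** h = h"
    unfolding Rk using lim(1) LIMSEQ_unique by fastforce
  have "sym_psd h"
    by (rule sym_psd_tendsto[OF lim(1) H])
  then have th: "transpose h = h"
    by (simp add: sym_psd_def)
  have r: "sym_psd r"
    by (rule sym_psd_tendsto[OF lim(2) Rk(3)])
  have r': "sym_psd (mat 1 - r)"
    by (rule sym_psd_tendsto[of "\<lambda>k. mat 1 - R k"]) (intro tendsto_intros lim Rk(4))+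
  have PP: "P ** P = P" and tP: "transpose P = P"
    by (simp_all add: P_def proj_mat_idempotent transpose_proj_mat ker_subspace)
  have hh: "pinv h ** h = mat 1 - P" "h ** pinv h = mat 1 - P"
    using pinv_symmetric[OF th] by (simp_all add: P_def)
  \<comment> \<open>Multiplying \<open>r ** h = h\<close> by the pseudoinverse shows that
    \<open>r\<close> acts as the identity on the range of \<open>mat 1 - P\<close>.\<close>
  have "(r ** h) ** pinv h = mat 1 - P"
    by (simp add: rh hh)
  then have rP: "r ** P = r - (mat 1 - P)"
    by (simp add: hh matrix_diff_ldistrib algebra_simps flip: matrix_mul_assoc)
  have "pinv h ** (h ** r) = mat 1 - P"
    by (simp add: hr hh)
  then have Pr: "P ** r = r - (mat 1 - P)"
    by (simp add: hh matrix_diff_rdistrib algebra_simps matrix_mul_assoc)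
  have S: "S = r - (mat 1 - P)"
    by (simp add: S_def hh)
  show S_eq: "S = P ** r ** P"
    by (simp add: S Pr rP matrix_diff_rdistrib PP)
  \<comment> \<open>Compression by \<open>P\<close> preserves positivity. With \<open>A = r\<close>
    it yields the lower bound, and with \<open>A = mat 1 - r\<close> the upper one, since
    \<open>P - S = P ** (mat 1 - r) ** P\<close>.\<close>
  have conj: "sym_psd (P ** A ** P)" if "sym_psd A" for A
    unfolding sym_psd_def
  proof (intro conjI allI)
    show "transpose (P ** A ** P) = P ** A ** P"
      using that tP by (simp add: sym_psd_def matrix_transpose_mul matrix_mul_assoc)
    fix x
    have "x \<bullet> (P ** A ** P *v x) = (P *v x) \<bullet> (A *v (P *v x))"
      using inner_symmetric_matrix[OF tP] by (simp flip: matrix_vector_mul_assoc)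
    then show "0 \<le> x \<bullet> (P ** A ** P *v x)"
      using that by (simp add: sym_psd_def)
  qed
  show "0 \<preceq>\<^sub>L S"
    using conj[OF r] by (simp add: loewner_le_def S_eq)
  show "S \<preceq>\<^sub>L P"
    using conj[OF r'] by (simp add: loewner_le_def S_eq matrix_diff_ldistrib matrix_diff_rdistrib PP)
qed


section \<open>Tikhonov regularization\<close>

text \<open>The minimizers form a sublevel set of \<open>g\<close>, which is closed and convex, and
  the point sought is its closest point to 0.\<close>

lemma ex1_min_norm_minimizer:
  fixes g :: "'a::euclidean_space \<Rightarrow> real"
  assumes cvx: "convex_on UNIV g" and cont: "continuous_on UNIV g"
    and ne: "\<exists>x. is_arg_min g (\<lambda>_. True) x"
  shows "\<exists>!x. is_arg_min norm (\<lambda>x. is_arg_min g (\<lambda>_. True) x) x"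
proof -
  let ?S = "{x. is_arg_min g (\<lambda>_. True) x}"
  obtain x1 where x1: "\<And>y. g x1 \<le> g y"
    using ne by (auto simp: is_arg_min_linorder)
  have S_eq: "?S = {x. g x \<le> g x1}"
    using x1 by (auto simp: is_arg_min_linorder intro: order_trans)
  have "closed ?S"
    unfolding S_eq by (intro closed_Collect_le cont continuous_intros)
  moreover have "convex ?S"
  proof -
    have "g (u *\<^sub>R x + v *\<^sub>R y) \<le> g x1"
      if "g x \<le> g x1" "g y \<le> g x1" "0 \<le> u" "0 \<le> v" "u + v = 1" for x y u v
    proof -
      have "g (u *\<^sub>R x + v *\<^sub>R y) \<le> u * g x + v * g y"
        using cvx that by (auto simp: convex_on_def)
      also have "\<dots> \<le> g x1"
        using that by (intro convex_bound_le) auto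
      finally show ?thesis .
    qed
    then show ?thesis
      unfolding S_eq convex_def by auto
  qed
  moreover have "?S \<noteq> {}"
    using ne by auto
  ultimately have S: "closed ?S" "convex ?S" "?S \<noteq> {}"
    by auto
  obtain x where "x \<in> ?S" "\<And>y. y \<in> ?S \<Longrightarrow> dist 0 x \<le> dist 0 y"
    using distance_attains_inf[OF S(1,3)] by blast
  then have "is_arg_min norm (\<lambda>x. is_arg_min g (\<lambda>_. True) x) x"
    by (simp add: is_arg_min_linorder[of norm])
  moreover have "y = z"
    if "is_arg_min norm (\<lambda>x. is_arg_min g (\<lambda>_. True) x) y"
      "is_arg_min norm (\<lambda>x. is_arg_min g (\<lambda>_. True) x) z" for y z
    by (rule any_closest_point_unique[OF S(2,1), of y z 0])
      (use that in \<open>auto simp: is_arg_min_linorder[of norm]\<close>)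
  ultimately show ?thesis
    by blast
qed

text \<open>Since \<open>x\<close> cannot beat \<open>x0\<close> in \<open>g\<close>, it must not
  lose in the penalty. Only a comparison with \<open>x0\<close> is assumed, so the lemma also
  excludes points outside a ball by contraposition.\<close>

lemma norm_regularized_minimizer_le:
  fixes g :: "'a::real_normed_vector \<Rightarrow> real"
  assumes "0 < e" "\<And>y. g x0 \<le> g y" "g x + e / 2 * (norm x)\<^sup>2 \<le> g x0 + e / 2 * (norm x0)\<^sup>2"
  shows "norm x \<le> norm x0"
proof -
  have "e / 2 * (norm x)\<^sup>2 \<le> e / 2 * (norm x0)\<^sup>2"
    using assms(2)[of x] assms(3) by linarith
  then show ?thesis
    using assms(1) by simp
qed

lemma ex1_regularized_minimizer:
  fixes g :: "'a::euclidean_space \<Rightarrow> real"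
  assumes cvx: "convex_on UNIV g" and cont: "continuous_on UNIV g"
    and ne: "\<exists>x. is_arg_min g (\<lambda>_. True) x" and e: "0 < e"
  shows "\<exists>!x. is_arg_min (\<lambda>x. g x + e / 2 * (norm x)\<^sup>2) (\<lambda>_. True) x"
proof -
  let ?h = "\<lambda>x. g x + e / 2 * (norm x)\<^sup>2"
  obtain x1 where x1: "\<And>y. g x1 \<le> g y"
    using ne by (auto simp: is_arg_min_linorder)
  have "\<exists>x\<in>cball 0 (norm x1). \<forall>y\<in>cball 0 (norm x1). ?h x \<le> ?h y"
    by (intro continuous_attains_inf continuous_intros continuous_on_subset[OF cont]) auto
  then obtain x where x: "\<And>y. norm y \<le> norm x1 \<Longrightarrow> ?h x \<le> ?h y"
    by (metis mem_cball_0)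
  \<comment> \<open>A minimizer over the ball is global: outside the ball the regularized value
    exceeds the one at \<open>x1\<close>, which belongs to the ball.\<close>
  have "?h x \<le> ?h y" for y
  proof (cases "norm y \<le> norm x1")
    case False
    then have "\<not> ?h y \<le> ?h x1"
      using norm_regularized_minimizer_le[where g = g, OF e x1] by blast
    then show ?thesis
      using x[of x1] by simp
  qed (rule x)
  then have "is_arg_min ?h (\<lambda>_. True) x"
    by (simp add: is_arg_min_linorder)
  moreover have "y = z" if "\<And>w. ?h y \<le> ?h w" "\<And>w. ?h z \<le> ?h w" for y z
  proof -
    \<comment> \<open>Strong convexity at the midpoint: by the parallelogram identity its penalty
      lies below the average by \<open>e * (norm (y - z))\<^sup>2 / 8\<close>, which contradicts
      minimality unless \<open>y = z\<close>.\<close>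
    let ?m = "(1/2) *\<^sub>R y + (1/2) *\<^sub>R z"
    have "g ?m \<le> 1/2 * g y + 1/2 * g z"
      using convex_onD[OF cvx, of "1/2" y z] by simp
    moreover have norm_m: "(norm ?m)\<^sup>2 = (norm y)\<^sup>2 / 2 + (norm z)\<^sup>2 / 2 - (norm (y - z))\<^sup>2 / 4"
      by (simp add: power2_norm_eq_inner inner_add_left inner_add_right inner_diff_left
          inner_diff_right inner_commute field_simps)
    have "e / 2 * (norm ?m)\<^sup>2
        = (e / 2 * (norm y)\<^sup>2) / 2 + (e / 2 * (norm z)\<^sup>2) / 2 - e * (norm (y - z))\<^sup>2 / 8"
      unfolding norm_m by (simp add: algebra_simps)
    ultimately have "e * (norm (y - z))\<^sup>2 \<le> 0"
      using that(1)[of ?m] that(2)[of ?m] by linarith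
    then show ?thesis
      using e by (simp add: mult_le_0_iff)
  qed
  ultimately show ?thesis
    by (auto simp: is_arg_min_linorder)
qed

text \<open>The part of the ball of radius \<open>norm x0\<close> at distance at least \<open>d\<close> from \<open>x0\<close> is compact and
  contains no minimizer of \<open>g\<close>, so \<open>g\<close> exceeds its minimum by a fixed amount there.\<close>

lemma regularized_minimizers_tendsto:
  fixes g :: "'a::euclidean_space \<Rightarrow> real"
  assumes cvx: "convex_on UNIV g" and cont: "continuous_on UNIV g"
    and x0: "is_arg_min norm (\<lambda>x. is_arg_min g (\<lambda>_. True) x) x0"
    and e: "\<And>k. 0 < e k" "e \<longlonglongrightarrow> 0"
    and x: "\<And>k. is_arg_min (\<lambda>x. g x + e k / 2 * (norm x)\<^sup>2) (\<lambda>_. True) (x k)"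
  shows "x \<longlonglongrightarrow> x0"
proof (rule tendstoI)
  fix d :: real
  assume d: "0 < d"
  let ?K = "cball 0 (norm x0) - ball x0 d"
  have min: "g x0 \<le> g y" for y
    using x0 by (simp add: is_arg_min_linorder)
  have xk: "g (x k) + e k / 2 * (norm (x k))\<^sup>2 \<le> g x0 + e k / 2 * (norm x0)\<^sup>2" for k
    using x[of k] by (simp add: is_arg_min_linorder)
  then have norm_le: "norm (x k) \<le> norm x0" for k
    using norm_regularized_minimizer_le[where g = g, OF e(1) min] by blast
  have unique: "y = x0" if "norm y \<le> norm x0" "g y \<le> g x0" for y
  proof -
    have y: "is_arg_min g (\<lambda>_. True) y"
      using that(2) min by (auto simp: is_arg_min_linorder intro: order_trans)
    then have "is_arg_min norm (\<lambda>x. is_arg_min g (\<lambda>_. True) x) y"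
      using x0 that(1) by (auto simp: is_arg_min_linorder[of norm] intro: order_trans)
    then show ?thesis
      using ex1_min_norm_minimizer[OF cvx cont] x0 y by blast
  qed
  show "\<forall>\<^sub>F k in sequentially. dist (x k) x0 < d"
  proof (cases "?K = {}")
    case True
    have "dist (x k) x0 < d" for k
      using True norm_le[of k] by (auto simp: dist_commute)
    then show ?thesis
      by simp
  next
    case False
    have "compact ?K"
      by (intro compact_diff) auto
    then obtain y where y: "y \<in> ?K" "\<And>z. z \<in> ?K \<Longrightarrow> g y \<le> g z"
      using continuous_attains_inf[of ?K g] False continuous_on_subset[OF cont] by blast
    \<comment> \<open>Being at distance at least \<open>d\<close> from \<open>x0\<close>, the point
      \<open>y\<close> is not a minimizer. The upper bound for \<open>g (x k)\<close> tends to
      \<open>g x0\<close>, so it eventually falls below this gap.\<close>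
    have "g x0 < g y"
      using y(1) unique[of y] d by force
    moreover have "(\<lambda>k. g x0 + e k / 2 * (norm x0)\<^sup>2) \<longlonglongrightarrow> g x0 + 0 / 2 * (norm x0)\<^sup>2"
      by (intro tendsto_intros e) simp
    ultimately have "\<forall>\<^sub>F k in sequentially. g x0 + e k / 2 * (norm x0)\<^sup>2 < g y"
      by (intro order_tendstoD) auto
    then show ?thesis
    proof eventually_elim
      case (elim k)
      have "0 \<le> e k / 2 * (norm (x k))\<^sup>2"
        using e(1)[of k] by simp
      then have "g (x k) < g y"
        using xk[of k] elim by linarith
      then have "x k \<notin> ?K"
        using y(2) by force
      then show ?case
        using norm_le[of k] by (simp add: dist_commute)
    qed
  qed
qed

lemma x_reg_tendsto_x_min:
  fixes f :: "real ^ 'n \<Rightarrow> real ^ 'm \<Rightarrow> real"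
  assumes f: "regular_problem \<Theta> f" "\<theta> \<in> \<Theta>" and e: "\<And>k. 0 < e k" "e \<longlonglongrightarrow> 0"
  shows "(\<lambda>k. x_reg f (e k) \<theta>) \<longlonglongrightarrow> x_min f \<theta>"
proof -
  let ?g = "\<lambda>x. f x \<theta>"
  have cvx: "convex_on UNIV ?g" and diff: "\<And>x. \<exists>D. GDERIV ?g x :> D"
    and ne: "\<exists>x. is_arg_min ?g (\<lambda>_. True) x"
    using f by (auto simp: regular_problem_def C11_def sol_set_def)
  have cont: "continuous_on UNIV ?g"
    using diff by (auto simp: gderiv_def intro!: continuous_at_imp_continuous_on
        dest: has_derivative_continuous)
  show ?thesis
  proof (rule regularized_minimizers_tendsto[OF cvx cont _ e])
    show "is_arg_min norm (\<lambda>x. is_arg_min ?g (\<lambda>_. True) x) (x_min f \<theta>)"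
      unfolding x_min_def sol_set_def mem_Collect_eq
      by (rule theI'[OF ex1_min_norm_minimizer[OF cvx cont ne]])
    show "is_arg_min (\<lambda>x. ?g x + e k / 2 * (norm x)\<^sup>2) (\<lambda>_. True) (x_reg f (e k) \<theta>)" for k
      unfolding x_reg_def by (rule theI'[OF ex1_regularized_minimizer[OF cvx cont ne e(1)]])
  qed
qed


section \<open>Block matrices and limits of conservative Jacobians\<close>

lemma vsnd_vconcat [simp]: "vsnd (vconcat x y) = y"
  by (simp add: vsnd_def vconcat_def vec_eq_iff)

lemma tendsto_vconcat:
  assumes "(x \<longlongrightarrow> a) F" "(y \<longlongrightarrow> b) F"
  shows "((\<lambda>k. vconcat (x k) (y k)) \<longlongrightarrow> vconcat a b) F"
proof -
  have "((\<lambda>k. case i of Inl j \<Rightarrow> x k $ j | Inr j \<Rightarrow> y k $ j) \<longlongrightarrow>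
      (case i of Inl j \<Rightarrow> a $ j | Inr j \<Rightarrow> b $ j)) F" for i
    by (cases i) (auto intro: tendsto_vec_nth assms)
  then show ?thesis
    unfolding vconcat_def by (intro tendsto_vec_lambda)
qed

text \<open>Splits a limit obtained by compactness, which carries no block structure of its own,
  into its two blocks.\<close>

lemma hcat_exhaust:
  obtains H M where "A = hcat H M"
proof
  show "A = hcat (\<chi> i. vfst (A $ i)) (\<chi> i. vsnd (A $ i))"
    by (auto simp: hcat_def vconcat_def vfst_def vsnd_def vec_eq_iff split: sum.split)
qed

lemma tendsto_hcatD:
  assumes "((\<lambda>k. hcat (H k) (M k)) \<longlongrightarrow> hcat h m) F"
  shows "(H \<longlongrightarrow> h) F" "(M \<longlongrightarrow> m) F"
proof -
  have *: "((\<lambda>k. hcat (H k) (M k) $ i $ j) \<longlongrightarrow> hcat h m $ i $ j) F" for i j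
    by (intro tendsto_vec_nth assms)
  show "(H \<longlongrightarrow> h) F"
    using *[of _ "Inl _"] by (intro vec_tendstoI) (simp add: hcat_def vconcat_def)
  show "(M \<longlongrightarrow> m) F"
    using *[of _ "Inr _"] by (intro vec_tendstoI) (simp add: hcat_def vconcat_def)
qed

text \<open>Local boundedness at \<open>z0\<close> bounds all but finitely many terms, and that
  suffices for a sequence.\<close>

lemma conservative_jacobian_bounded:
  assumes J: "conservative_jacobian U G J" and z: "\<And>k. z k \<in> U" "z \<longlonglongrightarrow> z0" "z0 \<in> U"
    and A: "\<And>k. A k \<in> J (z k)"
  shows "bounded (range A)"
proof -
  obtain r B where r: "0 < r" and B: "\<And>y V. y \<in> ball z0 r \<inter> U \<Longrightarrow> V \<in> J y \<Longrightarrow> norm V \<le> B"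
    using J z(3) unfolding conservative_jacobian_def by (elim conjE) blast
  have "\<forall>\<^sub>F k in sequentially. dist (z k) z0 < r"
    using z(2) r by (rule tendstoD)
  then have "\<forall>\<^sub>F k in sequentially. norm (A k) \<le> B"
    by eventually_elim (use B[OF _ A] z(1) in \<open>simp add: dist_commute\<close>)
  then have "Bseq A"
    by (rule BfunI)
  then show ?thesis
    by (simp add: Bseq_eq_bounded)
qed

text \<open>The graph is closed only relative to \<open>U \<times> UNIV\<close>, so the limit is
  taken in a closed set \<open>T\<close> that cuts out the graph, and \<open>z0 \<in> U\<close>
  brings it back.\<close>

lemma conservative_jacobian_closed:
  assumes J: "conservative_jacobian U G J" and z: "\<And>k. z k \<in> U" "z \<longlonglongrightarrow> z0" "z0 \<in> U"
    and A: "\<And>k. A k \<in> J (z k)" "A \<longlonglongrightarrow> A0"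
  shows "A0 \<in> J z0"
proof -
  have "closedin (top_of_set (U \<times> UNIV)) {(z, V). z \<in> U \<and> V \<in> J z}"
    using J by (simp add: conservative_jacobian_def)
  then obtain T where T: "closed T" "{(z, V). z \<in> U \<and> V \<in> J z} = (U \<times> UNIV) \<inter> T"
    by (auto simp: closedin_closed)
  have "(z k, A k) \<in> T" for k
    using T(2) z(1) A(1) by blast
  then have "(z0, A0) \<in> T"
    by (rule closed_sequentially[OF T(1) _ tendsto_Pair[OF z(2) A(2)]])
  then show ?thesis
    using T(2) z(3) by blast
qed

section \<open>Bounds and subsequential limits at the fixed parameter\<close>

theorem theorem10:
  fixes \<D> :: "nat \<Rightarrow> real list set set"
    and f :: "real ^ 'n \<Rightarrow> real ^ 'm \<Rightarrow> real"
    and \<Theta> \<O> :: "(real ^ 'm) set"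
    and J\<^sub>F :: "real ^ ('n::finite + 'm::finite) \<Rightarrow> (real ^ ('n::finite + 'm::finite) ^ 'n) set"
    and \<epsilon>bar :: real
    and \<theta> :: "real ^ 'm"
    and \<epsilon> :: "nat \<Rightarrow> real"
    and H R :: "nat \<Rightarrow> real ^ 'n ^ 'n"
    and M W V :: "nat \<Rightarrow> real ^ 'm ^ 'n"
  assumes "ominimal_structure \<D>"
    and "regular_problem \<Theta> f"
    and "definable_in \<D> \<Theta>"
    and "definable_in \<D> {(x, \<theta>', f x \<theta>') |x \<theta>'. \<theta>' \<in> \<Theta>}"
    and "\<O> \<subseteq> \<Theta>" and "open \<O>" and "definable_in \<D> \<O>"
    and "conservative_jacobian {z. vsnd z \<in> \<O>} (grad_x f) J\<^sub>F"
    and "definable_in \<D> {(z, A). vsnd z \<in> \<O> \<and> A \<in> J\<^sub>F z}"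
    and "\<epsilon>bar > 0"
    and "uniform_range_condition f \<O> \<epsilon>bar J\<^sub>F"
    and "\<theta> \<in> \<O>"
    and "\<And>k. 0 < \<epsilon> k \<and> \<epsilon> k \<le> \<epsilon>bar" and "\<epsilon> \<longlonglongrightarrow> 0"
    and "\<And>k. hcat (H k) (M k) \<in> J\<^sub>F (vconcat (x_reg f (\<epsilon> k) \<theta>) \<theta>)"
    and "\<And>k. R k = matrix_inv (H k + \<epsilon> k *\<^sub>R mat 1) ** H k"
    and "\<And>k. W k = pinv (H k) ** M k"
    and "\<And>k. V k = - (matrix_inv (H k + \<epsilon> k *\<^sub>R mat 1) ** M k)"
  shows "(\<forall>k. V k = - (R k ** W k)) \<and>
    (\<forall>k. V k \<in> J_reg f J\<^sub>F (\<epsilon> k) \<theta>) \<and>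
    bounded (range W) \<and> bounded (range V) \<and>
    (\<forall>r Vlim. strict_mono (r :: nat \<Rightarrow> nat) \<and> (V \<circ> r) \<longlonglongrightarrow> Vlim \<longrightarrow>
      (\<exists>s Hlim Mlim Wlim Rlim. strict_mono (s :: nat \<Rightarrow> nat) \<and>
         ((\<lambda>k. hcat (H k) (M k)) \<circ> r \<circ> s) \<longlonglongrightarrow> hcat Hlim Mlim \<and>
         hcat Hlim Mlim \<in> reachable f J\<^sub>F \<theta> \<and>
         (W \<circ> r \<circ> s) \<longlonglongrightarrow> Wlim \<and>
         (R \<circ> r \<circ> s) \<longlonglongrightarrow> Rlim \<and>
         Mlim = Hlim ** Wlim \<and>
         (let S = Rlim - pinv Hlim ** Hlim; P = proj_mat (ker Hlim) in
            S = P ** Rlim ** P \<and> 0 \<preceq>\<^sub>L S \<and> S \<preceq>\<^sub>L P \<and>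
            Vlim = - (pinv Hlim ** Mlim) - S ** Wlim) \<and>
         Vlim \<in> J_min f \<O> \<epsilon>bar J\<^sub>F \<theta> \<and>
         Hlim ** Vlim + Mlim = 0))"
proof -
  let ?U = "{z. vsnd z \<in> \<O>}"
  let ?A = "\<lambda>k. hcat (H k) (M k)"
  note reg = assms(2) and jac = assms(8) and \<theta> = assms(12) and e = assms(13,14)
    and sel = assms(15) and R = assms(16) and W = assms(17) and V = assms(18)
  have e_pos: "0 < \<epsilon> k" for k
    using e(1) by blast
  \<comment> \<open>The range condition is used for the compact set \<open>{\<theta>}\<close>, which
    gives one constant for all \<open>k\<close>.\<close>
  obtain C where C: "sym_psd (H k)" "\<exists>W0. M k = H k ** W0 \<and> onorm ((*v) W0) \<le> C" for k
    using assms(11) \<theta> e(1) sel unfolding uniform_range_condition_def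
    by (elim allE[of _ "{\<theta>}"]) fastforce
  then obtain W0 where W0: "M k = H k ** W0 k" "onorm ((*v) (W0 k)) \<le> C" for k
    by metis
  have tH: "transpose (H k) = H k" for k
    using C(1) by (simp add: sym_psd_def)
  have HW: "H k ** W k = M k" for k
    unfolding W W0(1) by (rule mult_pinv_range[OF tH])
  have V_RW: "V k = - (R k ** W k)" for k
    by (simp add: V R HW flip: matrix_mul_assoc)
  have V_J: "V k \<in> J_reg f J\<^sub>F (\<epsilon> k) \<theta>" for k
    unfolding J_reg_def V using sel by blast
  have W_bound: "onorm ((*v) (W k)) \<le> C" for k
  proof -
    \<comment> \<open>\<open>W k\<close> is the part of \<open>W0 k\<close> orthogonal to
      \<open>ker (H k)\<close>, so the bound is inherited although \<open>pinv (H k)\<close> itself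
      need not stay bounded.\<close>
    have "W k = (mat 1 - proj_mat (ker (H k))) ** W0 k"
      by (simp add: W W0(1) matrix_mul_assoc pinv_symmetric[OF tH])
    then show ?thesis
      using onorm_matrix_mult[OF norm_mat_1_diff_proj_mat[OF ker_subspace]] W0(2)
      by (metis order_trans)
  qed
  have R_le: "norm (R k *v x) \<le> norm x" for k x
    unfolding R by (rule regularized_inverse_mult[OF C(1) e_pos])
  have bdd_W: "bounded (range W)"
    by (rule bounded_range_onorm[OF W_bound])
  have "onorm ((*v) (R k)) \<le> 1" for k
    by (rule onorm_le) (simp add: R_le)
  then have bdd_R: "bounded (range R)"
    by (rule bounded_range_onorm)
  have "bounded (range (\<lambda>k. R k ** W k))"
    by (rule bounded_range_onorm[OF order_trans[OF onorm_matrix_mult[OF R_le] W_bound]])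
  then have bdd_V: "bounded (range V)"
    by (simp add: V_RW bounded_iff)
  have x_lim: "(\<lambda>k. x_reg f (\<epsilon> k) \<theta>) \<longlonglongrightarrow> x_min f \<theta>"
    using x_reg_tendsto_x_min[OF reg] \<theta> assms(5) e_pos e(2) by blast
  then have z_lim: "(\<lambda>k. vconcat (x_reg f (\<epsilon> k) \<theta>) \<theta>) \<longlonglongrightarrow> vconcat (x_min f \<theta>) \<theta>"
    by (intro tendsto_vconcat tendsto_const)
  have bdd_A: "bounded (range ?A)"
    by (rule conservative_jacobian_bounded[OF jac _ z_lim _ sel]) (simp_all add: \<theta>)
  have "\<exists>s Hlim Mlim Wlim Rlim. strict_mono (s :: nat \<Rightarrow> nat) \<and>
         (?A \<circ> r \<circ> s) \<longlonglongrightarrow> hcat Hlim Mlim \<and>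
         hcat Hlim Mlim \<in> reachable f J\<^sub>F \<theta> \<and>
         (W \<circ> r \<circ> s) \<longlonglongrightarrow> Wlim \<and>
         (R \<circ> r \<circ> s) \<longlonglongrightarrow> Rlim \<and>
         Mlim = Hlim ** Wlim \<and>
         (let S = Rlim - pinv Hlim ** Hlim; P = proj_mat (ker Hlim) in
            S = P ** Rlim ** P \<and> 0 \<preceq>\<^sub>L S \<and> S \<preceq>\<^sub>L P \<and>
            Vlim = - (pinv Hlim ** Mlim) - S ** Wlim) \<and>
         Vlim \<in> J_min f \<O> \<epsilon>bar J\<^sub>F \<theta> \<and>
         Hlim ** Vlim + Mlim = 0"
    if r: "strict_mono (r :: nat \<Rightarrow> nat)" and Vr: "(V \<circ> r) \<longlonglongrightarrow> Vlim" for r Vlim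
  proof -
    \<comment> \<open>Compactness is applied to the triple, so that one subsequence serves all three
      limits; \<open>V\<close> already converges along \<open>r\<close>.\<close>
    let ?T = "\<lambda>k. (?A k, W k, R k)"
    have "bounded (range ?A \<times> range W \<times> range R)"
      by (intro bounded_Times bdd_A bdd_W bdd_R)
    then have "bounded (range (?T \<circ> r))"
      by (rule bounded_subset) auto
    then obtain l s where s: "strict_mono (s :: nat \<Rightarrow> nat)" and "(?T \<circ> r \<circ> s) \<longlonglongrightarrow> l"
      using bounded_imp_convergent_subsequence by blast
    moreover obtain A Wlim Rlim where "l = (A, Wlim, Rlim)"
      using prod_cases3 by blast
    moreover obtain Hlim Mlim where "A = hcat Hlim Mlim"
      by (rule hcat_exhaust)
    ultimately have "(?T \<circ> r \<circ> s) \<longlonglongrightarrow> (hcat Hlim Mlim, Wlim, Rlim)"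
      by simp
    note T_lim = tendsto_fst[OF this] tendsto_fst[OF tendsto_snd[OF this]]
      tendsto_snd[OF tendsto_snd[OF this]]
    define q where "q = r \<circ> s"
    have q: "strict_mono q"
      unfolding q_def by (rule strict_mono_o[OF r s])
    have A_lim: "(\<lambda>k. hcat (H (q k)) (M (q k))) \<longlonglongrightarrow> hcat Hlim Mlim"
      and W_lim: "(\<lambda>k. W (q k)) \<longlonglongrightarrow> Wlim" and R_lim: "(\<lambda>k. R (q k)) \<longlonglongrightarrow> Rlim"
      using T_lim by (simp_all add: q_def o_def)
    have H_lim: "(\<lambda>k. H (q k)) \<longlonglongrightarrow> Hlim" and M_lim: "(\<lambda>k. M (q k)) \<longlonglongrightarrow> Mlim"
      using tendsto_hcatD[OF A_lim] by blast+
    have V_lim: "(\<lambda>k. V (q k)) \<longlonglongrightarrow> Vlim"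
      using LIMSEQ_subseq_LIMSEQ[OF Vr s] by (simp add: q_def o_def)
    have e_lim: "(\<lambda>k. \<epsilon> (q k)) \<longlonglongrightarrow> 0"
      using LIMSEQ_subseq_LIMSEQ[OF e(2) q] by (simp add: o_def)
    have xq_lim: "(\<lambda>k. x_reg f (\<epsilon> (q k)) \<theta>) \<longlonglongrightarrow> x_min f \<theta>"
      using LIMSEQ_subseq_LIMSEQ[OF x_lim q] by (simp add: o_def)
    have zq_lim: "(\<lambda>k. vconcat (x_reg f (\<epsilon> (q k)) \<theta>) \<theta>) \<longlonglongrightarrow> vconcat (x_min f \<theta>) \<theta>"
      by (intro tendsto_vconcat tendsto_const xq_lim)
    have "hcat Hlim Mlim \<in> J\<^sub>F (vconcat (x_min f \<theta>) \<theta>)"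
      by (rule conservative_jacobian_closed[OF jac _ zq_lim _ sel A_lim]) (simp_all add: \<theta>)
    then have reach: "hcat Hlim Mlim \<in> reachable f J\<^sub>F \<theta>"
      unfolding reachable_def using e_pos sel e_lim A_lim
      by (auto intro!: exI[of _ "\<lambda>k. \<epsilon> (q k)"] exI[of _ "\<lambda>k. hcat (H (q k)) (M (q k))"])
    \<comment> \<open>The parameter sequence in \<open>J_min\<close> may be constant, equal to
      \<open>\<theta>\<close>.\<close>
    have V_J_min: "Vlim \<in> J_min f \<O> \<epsilon>bar J\<^sub>F \<theta>"
      unfolding J_min_def using \<theta> e(1) V_J e_lim V_lim xq_lim
      by (auto intro!: exI[of _ "\<lambda>k. \<theta>"] exI[of _ "\<lambda>k. \<epsilon> (q k)"] exI[of _ "\<lambda>k. V (q k)"])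
    have "(\<lambda>k. H (q k) ** W (q k)) \<longlonglongrightarrow> Hlim ** Wlim"
      by (rule tendsto_matrix_mult[OF H_lim W_lim])
    then have M_eq: "Mlim = Hlim ** Wlim"
      using M_lim LIMSEQ_unique by (auto simp: HW)
    have "(\<lambda>k. - (R (q k) ** W (q k))) \<longlonglongrightarrow> - (Rlim ** Wlim)"
      by (intro tendsto_minus tendsto_matrix_mult R_lim W_lim)
    then have V_eq: "Vlim = - (Rlim ** Wlim)"
      using V_lim LIMSEQ_unique by (auto simp: V_RW)
    note S = spectral_remainder_limit[OF C(1) e_pos e_lim R H_lim R_lim]
    have "Vlim = - (pinv Hlim ** Mlim) - (Rlim - pinv Hlim ** Hlim) ** Wlim"
      by (simp add: V_eq M_eq matrix_diff_rdistrib matrix_mul_assoc)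
    \<comment> \<open>Here \<open>Hlim ** Rlim = Hlim\<close> makes \<open>Hlim ** Vlim\<close>
      equal to \<open>- (Hlim ** Wlim)\<close>, which is \<open>- Mlim\<close>.\<close>
    moreover have "Hlim ** Vlim + Mlim = 0"
      by (simp add: V_eq M_eq matrix_mult_uminus matrix_mul_assoc S(1))
    ultimately show ?thesis
      using s A_lim W_lim R_lim reach M_eq V_J_min S(2-4)
      unfolding Let_def q_def o_def by blast
  qed
  then show ?thesis
    using V_RW V_J bdd_W bdd_V by blast
qed

end
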